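(* Let $X$ be a finite dataset and fix $\epsilon\in\mathbb{R}$ and a positive integer $MinPts$. Let $\{\mathbb{B}_i\}_{i\in I}$ be a filtration of covers of $X$ by bins, and let DBSCAN with parameters $\epsilon$ and $MinPts$ be used to cluster each bin of each $\mathbb{B}_i$; let $\mathbb{C}_{\mathbb{B}_i}$ be the resulting cluster cover. If no free-border points exist with respect to $\epsilon$ and $MinPts$ (in any of the bins), then there is a filtration of cluster covers $$\{c^{\mathbb{B}_i,\mathbb{B}_j}:\mathbb{C}_{\mathbb{B}_i}\to\mathbb{C}_{\mathbb{B}_j},\ \forall\, \mathbb{B}_i\le \mathbb{B}_j\}.$$
   Context: DBSCAN. Let $Y$ be a finite (ordered) set of points in a metric space, $\epsilon\in\mathbb{R}$, $MinPts$ a positive integer, and $N_\epsilon(p)=\{q\in Y: dist(p,q)\le\epsilon\}$ for $p\in Y$. A point $p\in Y$ is a core point if $|N_\epsilon(p)|\ge MinPts$; a border point if it is not core but lies in $N_\epsilon(p')$ for some core point $p'$; and noise otherwise. A point $q$ is directly density-reachable from $p$ if $p$ is core and $q\in N_\epsilon(p)$. A point $q$ is density-reachable from $p$ if there are points $p=\alpha_1,\dots,\alpha_n=q$ in $Y$, $n\ge 2$, with each $\alpha_{i+1}$ directly density-reachable from $\alpha_i$. Points $p,q$ are density-connected if there is a point $o\in Y$ from which both are density-reachable. DBSCAN outputs a partition $Y=C_1\sqcup\dots\sqcup C_n\sqcup N$, with $N$ the set of noise points and the clusters $C_i$, each containing at least one core point, satisfying: (Maximality) if $p\in C_i$, $q\notin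 \bigsqcup_{j<i}C_j$ and $q$ is density-reachable from $p$, then $q\in C_i$; (Connectivity) any $p,q\in C_i$ are density-connected. The assignment of some border points may depend on the ordering of $Y$. A point $s\in Y$ is a free-border point with respect to $\epsilon$ and $MinPts$ if $|N_\epsilon(s)|<MinPts$ and there are core points $p,q\in Y$ with $s\in N_\epsilon(p)$, $s\in N_\epsilon(q)$ and $p$ not density-connected to $q$. Bins and cluster covers. A bin is a subset of $X$; $\mathbb{B}_i$ is a finite indexed collection of bins covering $X$. DBSCAN is run separately inside each bin (with $Y$ = the bin). The cluster cover $\mathbb{C}_{\mathbb{B}_i}$ is the family of all clusters so obtained, indexed by the bin they come from (clusters in different bins are different elements even if equal as sets); noise points belong to no cluster, and the word "cover" is used regardless. Filtration of covers. A family $\{\mathbb{U}_\lambda\}$ of covers indexed by a partially ordered parameter set is a filtration if it has maps $u^{\lambda,\mu}:\mathbb{U}_\lambda\to\mathbb{U}_\mu$ for $\lambda\le\mu$ such that $u^{\lambda,\mu}(U)=V$ implies $U\subseteq V$, and $u^{\mu,\nu}\circ u^{\lambda,\mu}=u^{\lambda,\nu}$ for $\lambda\le\mu\le\nu$. The same definition is used for cluster covers. For bin covers we write $\mathbb{B}_i\le\mathbb{B}_j$ (for $i\le j$), so every bin in $\mathbb{B}_i$ is contained in a bin of $\mathbb{B}_j$. *)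

theory Defs
  imports Complex_Main "HOL-Library.FuncSet"
begin

definition eps_nbhd :: "'a::metric_space set \<Rightarrow> real \<Rightarrow> 'a \<Rightarrow> 'a set" where
  "eps_nbhd Y \<epsilon> p = {q \<in> Y. dist p q \<le> \<epsilon>}"

definition core_point :: "'a::metric_space set \<Rightarrow> real \<Rightarrow> nat \<Rightarrow> 'a \<Rightarrow> bool" where
  "core_point Y \<epsilon> MinPts p \<longleftrightarrow> p \<in> Y \<and> card (eps_nbhd Y \<epsilon> p) \<ge> MinPts"

definition border_point :: "'a::metric_space set \<Rightarrow> real \<Rightarrow> nat \<Rightarrow> 'a \<Rightarrow> bool" where
  "border_point Y \<epsilon> MinPts p \<longleftrightarrow>
     p \<in> Y \<and> \<not> core_point Y \<epsilon> MinPts p \<and>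
     (\<exists>p'. core_point Y \<epsilon> MinPts p' \<and> p \<in> eps_nbhd Y \<epsilon> p')"

definition noise :: "'a::metric_space set \<Rightarrow> real \<Rightarrow> nat \<Rightarrow> 'a set" where
  "noise Y \<epsilon> MinPts =
     {p \<in> Y. \<not> core_point Y \<epsilon> MinPts p \<and> \<not> border_point Y \<epsilon> MinPts p}"

text \<open>In the two reachability relations the first point argument is the source:
  \<open>density_reachable Y \<epsilon> MinPts p q\<close> says that \<open>q\<close> is density-reachable from \<open>p\<close>.\<close>

definition directly_density_reachable ::
    "'a::metric_space set \<Rightarrow> real \<Rightarrow> nat \<Rightarrow> 'a \<Rightarrow> 'a \<Rightarrow> bool" where
  "directly_density_reachable Y \<epsilon> MinPts p q \<longleftrightarrow>
     core_point Y \<epsilon> MinPts p \<and> q \<in> eps_nbhd Y \<epsilon> p"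

definition density_reachable ::
    "'a::metric_space set \<Rightarrow> real \<Rightarrow> nat \<Rightarrow> 'a \<Rightarrow> 'a \<Rightarrow> bool" where
  "density_reachable Y \<epsilon> MinPts p q \<longleftrightarrow>
     (\<exists>\<alpha>. length \<alpha> \<ge> 2 \<and> set \<alpha> \<subseteq> Y \<and> hd \<alpha> = p \<and> last \<alpha> = q \<and>
          successively (directly_density_reachable Y \<epsilon> MinPts) \<alpha>)"

definition density_connected ::
    "'a::metric_space set \<Rightarrow> real \<Rightarrow> nat \<Rightarrow> 'a \<Rightarrow> 'a \<Rightarrow> bool" where
  "density_connected Y \<epsilon> MinPts p q \<longleftrightarrow>
     (\<exists>z\<in>Y. density_reachable Y \<epsilon> MinPts z p \<and> density_reachable Y \<epsilon> MinPts z q)"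

definition free_border_point :: "'a::metric_space set \<Rightarrow> real \<Rightarrow> nat \<Rightarrow> 'a \<Rightarrow> bool" where
  "free_border_point Y \<epsilon> MinPts s \<longleftrightarrow>
     s \<in> Y \<and> card (eps_nbhd Y \<epsilon> s) < MinPts \<and>
     (\<exists>p q. core_point Y \<epsilon> MinPts p \<and> core_point Y \<epsilon> MinPts q \<and>
            s \<in> eps_nbhd Y \<epsilon> p \<and> s \<in> eps_nbhd Y \<epsilon> q \<and>
            \<not> density_connected Y \<epsilon> MinPts p q)"

text \<open>The list \<open>Cs\<close> is a possible sequence of clusters \<open>C\<^sub>1, \<dots>, C\<^sub>n\<close> returned by DBSCAN on \<open>Y\<close>.
  This is a relation rather than a function because the assignment of border points
  (and the numbering of the clusters) may depend on the order in which \<open>Y\<close> is traversed;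
  the clauses after the partition conditions are Maximality and Connectivity.\<close>

definition dbscan_output ::
    "'a::metric_space set \<Rightarrow> real \<Rightarrow> nat \<Rightarrow> 'a set list \<Rightarrow> bool" where
  "dbscan_output Y \<epsilon> MinPts Cs \<longleftrightarrow>
     \<Union> (set Cs) \<union> noise Y \<epsilon> MinPts = Y \<and>
     \<Union> (set Cs) \<inter> noise Y \<epsilon> MinPts = {} \<and>
     (\<forall>i<length Cs. \<forall>j<length Cs. i \<noteq> j \<longrightarrow> Cs ! i \<inter> Cs ! j = {}) \<and>
     (\<forall>i<length Cs. \<exists>p\<in>Cs ! i. core_point Y \<epsilon> MinPts p) \<and>
     (\<forall>i<length Cs. \<forall>p q. p \<in> Cs ! i \<longrightarrow> q \<notin> (\<Union>j<i. Cs ! j) \<longrightarrow>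
        density_reachable Y \<epsilon> MinPts p q \<longrightarrow> q \<in> Cs ! i) \<and>
     (\<forall>i<length Cs. \<forall>p\<in>Cs ! i. \<forall>q\<in>Cs ! i. density_connected Y \<epsilon> MinPts p q)"

definition bin_cover :: "'a set \<Rightarrow> 'b set \<Rightarrow> ('b \<Rightarrow> 'a set) \<Rightarrow> bool" where
  "bin_cover X J B \<longleftrightarrow> finite J \<and> (\<forall>b\<in>J. B b \<subseteq> X) \<and> (\<Union>b\<in>J. B b) = X"

text \<open>The elements of the cluster cover are pairs of a bin index and a cluster of that bin, so that
  equal clusters in different bins stay different; the underlying set is the second component.\<close>

definition cluster_cover :: "'b set \<Rightarrow> ('b \<Rightarrow> 'a set list) \<Rightarrow> ('b \<times> 'a set) set" where
  "cluster_cover J Cs = (SIGMA b:J. set (Cs b))"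

text \<open>\<open>K i\<close> is the set of elements of the \<open>i\<close>-th (cluster) cover and \<open>U i k\<close> the underlying set of
  its element \<open>k\<close>. That the \<open>i\<close>-th family covers the data is deliberately not part of the definition:
  cluster covers may miss noise points, and for bins it is stated by \<open>bin_cover\<close>.
  The maps \<open>u i i\<close> are not required to be identities.\<close>

definition filtration ::
    "'i::order set \<Rightarrow> ('i \<Rightarrow> 'k set) \<Rightarrow> ('i \<Rightarrow> 'k \<Rightarrow> 'a set) \<Rightarrow> ('i \<Rightarrow> 'i \<Rightarrow> 'k \<Rightarrow> 'k) \<Rightarrow> bool" where
  "filtration I K U u \<longleftrightarrow>
     (\<forall>i\<in>I. \<forall>j\<in>I. i \<le> j \<longrightarrow>
        u i j \<in> K i \<rightarrow> K j \<and> (\<forall>k\<in>K i. U i k \<subseteq> U j (u i j k))) \<and>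
     (\<forall>i\<in>I. \<forall>j\<in>I. \<forall>l\<in>I. i \<le> j \<longrightarrow> j \<le> l \<longrightarrow>
        (\<forall>k\<in>K i. u j l (u i j k) = u i l k))"

end

theory Submission
  imports Defs
begin

text \<open>
  Between core points of one bin, density-reachability is an equivalence relation: a chain all of
  whose points are core can be walked backwards. So a core point spans a class of core points,
  and the points reachable from it form that class together with its border points. The only
  obstruction to clusters being exactly these reachable sets is a border point shared by two
  classes, which goes to whichever cluster is built first; such a point is a free-border point.
  Without free-border points two core points that reach a common point reach each other
  (\<open>reach_of_common_target\<close>), so a cluster contains everything its core points reach, whatever
  its position in the output (\<open>cluster_absorbs_reachable\<close>).

  Reachable sets only grow when a bin grows, since neighbourhoods do and core points therefore
  remain core. Hence a cluster \<open>C\<close> of a bin, which lies in the set reached by one of its core points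
  \<open>p\<close>, is contained in the cluster of \<open>p\<close> in any larger bin. Clusters of one bin are disjoint and
  \<open>C\<close> is nonempty, so that larger cluster is determined by \<open>C \<subseteq> C'\<close> alone
  (\<open>cluster_in_larger_bin\<close>). Sending \<open>C\<close> to it defines the maps of cluster covers, and uniqueness
  makes them compose.
\<close>

section \<open>Density-reachability as a transitive closure\<close>

lemma tranclp_of_successively:
  "successively R \<alpha> \<Longrightarrow> length \<alpha> \<ge> 2 \<Longrightarrow> R\<^sup>+\<^sup>+ (hd \<alpha>) (last \<alpha>)"
proof (induction \<alpha> rule: induct_list012)
  case (3 x y zs)
  show ?case
  proof (cases zs)
    case Nil
    then show ?thesis using 3 by auto
  next
    case (Cons z zs')
    then have "R x y" "R\<^sup>+\<^sup>+ y (last (y # zs))"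
      using 3 by auto
    then show ?thesis by (simp add: tranclp_into_tranclp2)
  qed
qed auto

lemma density_reachable_iff_tranclp:
  "density_reachable Y e m p q \<longleftrightarrow> (directly_density_reachable Y e m)\<^sup>+\<^sup>+ p q"
proof
  assume "density_reachable Y e m p q"
  then show "(directly_density_reachable Y e m)\<^sup>+\<^sup>+ p q"
    unfolding density_reachable_def using tranclp_of_successively by blast
next
  assume "(directly_density_reachable Y e m)\<^sup>+\<^sup>+ p q"
  then show "density_reachable Y e m p q"
  proof (induction rule: tranclp_induct)
    case (base y)
    then have "p \<in> Y" "y \<in> Y"
      by (auto simp: directly_density_reachable_def core_point_def eps_nbhd_def)
    with base show ?case
      unfolding density_reachable_def by (intro exI[of _ "[p, y]"]) auto
  next
    case (step y z)
    from step.IH obtain \<alpha> where \<alpha>: "length \<alpha> \<ge> 2" "set \<alpha> \<subseteq> Y" "hd \<alpha> = p" "last \<alpha> = y"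
      "successively (directly_density_reachable Y e m) \<alpha>"
      unfolding density_reachable_def by blast
    have "z \<in> Y"
      using step.hyps by (auto simp: directly_density_reachable_def eps_nbhd_def)
    moreover have "\<alpha> \<noteq> []" using \<alpha>(1) by auto
    ultimately show ?case
      unfolding density_reachable_def using \<alpha> step.hyps
      by (intro exI[of _ "\<alpha> @ [z]"]) (auto simp: successively_append_iff)
  qed
qed

lemma density_reachable_trans:
  "density_reachable Y e m p q \<Longrightarrow> density_reachable Y e m q r \<Longrightarrow> density_reachable Y e m p r"
  unfolding density_reachable_iff_tranclp by (rule tranclp_trans)

lemma density_reachable_direct:
  "directly_density_reachable Y e m p q \<Longrightarrow> density_reachable Y e m p q"
  unfolding density_reachable_iff_tranclp by (rule tranclp.r_into_trancl)

lemma density_reachable_source_core: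
  assumes "density_reachable Y e m p q"
  shows "core_point Y e m p"
  using assms unfolding density_reachable_iff_tranclp
  by (induction rule: tranclp_induct) (auto simp: directly_density_reachable_def)

text \<open>With \<open>m = 0\<close> a negative radius would make every point core although no point is its own
  neighbour; a positive \<open>m\<close> forces a core point to have a neighbour, hence \<open>e \<ge> 0\<close>.\<close>

lemma core_point_reaches_itself:
  assumes "core_point Y e m p" "m > 0"
  shows "density_reachable Y e m p p"
proof (rule density_reachable_direct)
  have "eps_nbhd Y e p \<noteq> {}"
    using assms by (auto simp: core_point_def)
  then obtain q where "dist p q \<le> e"
    by (auto simp: eps_nbhd_def)
  then have "0 \<le> e"
    using zero_le_dist[of p q] by linarith
  then show "directly_density_reachable Y e m p p"
    using assms(1) by (auto simp: directly_density_reachable_def eps_nbhd_def core_point_def)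
qed

text \<open>If the last step of a chain starts at \<open>y\<close>, the earlier part of the chain either is empty or
  reaches \<open>y\<close>; reflexivity at core points merges the two cases.\<close>

lemma density_reachable_last_step:
  assumes "density_reachable Y e m p q" "m > 0"
  obtains y where "density_reachable Y e m p y" "directly_density_reachable Y e m y q"
proof -
  from assms(1) have "(directly_density_reachable Y e m)\<^sup>+\<^sup>+ p q"
    by (simp add: density_reachable_iff_tranclp)
  then consider "directly_density_reachable Y e m p q"
    | y where "(directly_density_reachable Y e m)\<^sup>+\<^sup>+ p y" "directly_density_reachable Y e m y q"
    by (metis tranclp.cases)
  then show thesis
  proof cases
    case 1
    then have "core_point Y e m p" by (simp add: directly_density_reachable_def)
    then show thesis using that 1 core_point_reaches_itself assms(2) by blast
  next
    case (2 y)
    then show thesis using that by (simp add: density_reachable_iff_tranclp)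
  qed
qed

text \<open>Every point of a chain that is followed by another one is core, so only the last point can
  prevent the chain from being reversed.\<close>

lemma density_reachable_sym:
  assumes "density_reachable Y e m p q" "core_point Y e m q"
  shows "density_reachable Y e m q p"
  using assms unfolding density_reachable_iff_tranclp
proof (induction rule: tranclp_induct)
  case (base y)
  then show ?case
    by (auto simp: directly_density_reachable_def eps_nbhd_def core_point_def dist_commute)
next
  case (step y z)
  have "core_point Y e m y"
    using step.hyps(2) by (simp add: directly_density_reachable_def)
  moreover from this have "directly_density_reachable Y e m z y"
    using step by (auto simp: directly_density_reachable_def eps_nbhd_def core_point_def dist_commute)
  ultimately show ?case
    using step.IH by (meson tranclp_into_tranclp2)
qed

lemma density_connected_core_reachable:
  assumes "density_connected Y e m p q" "core_point Y e m p"
  shows "density_reachable Y e m p q"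
  using assms density_reachable_sym density_reachable_trans
  unfolding density_connected_def by blast

section \<open>Clusters in the absence of free-border points\<close>

text \<open>If the common target \<open>s\<close> is core, the second chain can be reversed. Otherwise \<open>s\<close> neighbours
  the two core points from which the chains enter it, and these must be connected because \<open>s\<close> is
  not a free-border point.\<close>

lemma reach_of_common_target:
  assumes no_free: "\<not> free_border_point Y e m s" and "m > 0"
    and p: "density_reachable Y e m p s" and q: "density_reachable Y e m q s"
  shows "density_reachable Y e m p q"
proof (cases "core_point Y e m s")
  case True
  then show ?thesis using p q density_reachable_sym density_reachable_trans by blast
next
  case False
  obtain p1 where p1: "density_reachable Y e m p p1" "directly_density_reachable Y e m p1 s"
    using density_reachable_last_step[OF p \<open>m > 0\<close>] .
  obtain q1 where q1: "density_reachable Y e m q q1" "directly_density_reachable Y e m q1 s"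
    using density_reachable_last_step[OF q \<open>m > 0\<close>] .
  have cores: "core_point Y e m p1" "core_point Y e m q1"
    and nbhds: "s \<in> eps_nbhd Y e p1" "s \<in> eps_nbhd Y e q1"
    using p1(2) q1(2) by (auto simp: directly_density_reachable_def)
  have "s \<in> Y" using nbhds by (simp add: eps_nbhd_def)
  then have "card (eps_nbhd Y e s) < m"
    using False by (simp add: core_point_def)
  then have "density_connected Y e m p1 q1"
    using no_free cores nbhds \<open>s \<in> Y\<close> unfolding free_border_point_def by blast
  then have "density_reachable Y e m p1 q1"
    using cores by (simp add: density_connected_core_reachable)
  moreover have "density_reachable Y e m q1 q"
    using density_reachable_sym q1(1) cores(2) by blast
  ultimately show ?thesis
    using p1(1) density_reachable_trans by blast
qed

lemma dbscan_clusters_disjoint: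
  assumes "dbscan_output Y e m Cs" "C \<in> set Cs" "D \<in> set Cs" "x \<in> C" "x \<in> D"
  shows "C = D"
  using assms unfolding dbscan_output_def in_set_conv_nth by blast

lemma dbscan_cluster_has_core:
  assumes "dbscan_output Y e m Cs" "C \<in> set Cs"
  obtains p where "p \<in> C" "core_point Y e m p"
  using assms unfolding dbscan_output_def in_set_conv_nth by blast

lemma dbscan_cluster_of_reachable_point:
  assumes out: "dbscan_output Y e m Cs" and "m > 0" and "density_reachable Y e m p q"
  obtains j where "j < length Cs" "q \<in> Cs ! j"
proof -
  obtain y where "directly_density_reachable Y e m y q"
    using density_reachable_last_step[OF assms(3,2)] .
  then have "q \<in> Y" "q \<notin> noise Y e m"
    by (auto simp: directly_density_reachable_def eps_nbhd_def noise_def border_point_def)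
  then have "q \<in> \<Union> (set Cs)"
    using out unfolding dbscan_output_def by blast
  then show thesis using that by (auto simp: in_set_conv_nth)
qed

text \<open>Maximality alone gives this only for points that no earlier cluster has claimed. If an
  earlier cluster has claimed \<open>q\<close>, a core point of that cluster and \<open>p\<close> reach each other through
  \<open>q\<close>, and maximality of the earlier cluster puts \<open>p\<close> there as well.\<close>

lemma cluster_absorbs_reachable:
  assumes out: "dbscan_output Y e m Cs" and "m > 0"
    and no_free: "\<not> (\<exists>s. free_border_point Y e m s)"
    and "C \<in> set Cs" and "p \<in> C" and reach: "density_reachable Y e m p q"
  shows "q \<in> C"
proof -
  from out have
    disj: "\<And>i j. i < length Cs \<Longrightarrow> j < length Cs \<Longrightarrow> i \<noteq> j \<Longrightarrow> Cs ! i \<inter> Cs ! j = {}" and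
    maximal: "\<And>i p q. i < length Cs \<Longrightarrow> p \<in> Cs ! i \<Longrightarrow> q \<notin> (\<Union>j<i. Cs ! j) \<Longrightarrow>
      density_reachable Y e m p q \<Longrightarrow> q \<in> Cs ! i" and
    connected: "\<And>i p q. i < length Cs \<Longrightarrow> p \<in> Cs ! i \<Longrightarrow> q \<in> Cs ! i \<Longrightarrow>
      density_connected Y e m p q"
    unfolding dbscan_output_def by blast+
  obtain i where i: "i < length Cs" "C = Cs ! i"
    using \<open>C \<in> set Cs\<close> by (auto simp: in_set_conv_nth)
  obtain j where j: "j < length Cs" "q \<in> Cs ! j"
    using dbscan_cluster_of_reachable_point[OF out \<open>m > 0\<close> reach] .
  obtain r where r: "r \<in> Cs ! j" "core_point Y e m r"
    using dbscan_cluster_has_core[OF out] j(1) nth_mem by metis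
  have "density_reachable Y e m r q"
    using connected j r density_connected_core_reachable by blast
  then have "density_reachable Y e m r p"
    using reach_of_common_target no_free reach \<open>m > 0\<close> by blast
  moreover have "p \<notin> (\<Union>k<j. Cs ! k)" if "j < i"
    using disj[of _ i] i \<open>p \<in> C\<close> that by (auto dest: less_trans)
  ultimately have "p \<in> Cs ! j" if "j < i"
    using maximal j(1) r(1) that by blast
  then have "\<not> j < i"
    using disj[of j i] i j(1) \<open>p \<in> C\<close> by blast
  have "q \<notin> Cs ! k" if "k < i" for k
    using disj[of k j] i(1) j \<open>\<not> j < i\<close> that by auto
  then have "q \<notin> (\<Union>k<i. Cs ! k)"
    by blast
  then show ?thesis
    using maximal i \<open>p \<in> C\<close> reach by blast
qed

section \<open>Clusters in a larger bin\<close>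

lemma core_point_mono:
  assumes "core_point Y e m p" "Y \<subseteq> Z" "finite Z"
  shows "core_point Z e m p"
proof -
  have "card (eps_nbhd Y e p) \<le> card (eps_nbhd Z e p)"
    using assms(2,3) by (intro card_mono) (auto simp: eps_nbhd_def)
  then show ?thesis
    using assms(1,2) by (auto simp: core_point_def)
qed

lemma density_reachable_mono:
  assumes "density_reachable Y e m p q" "Y \<subseteq> Z" "finite Z"
  shows "density_reachable Z e m p q"
proof -
  have "directly_density_reachable Z e m x y" if "directly_density_reachable Y e m x y" for x y
    using core_point_mono[OF _ assms(2,3)] assms(2) that
    by (auto simp: directly_density_reachable_def eps_nbhd_def)
  with assms(1) show ?thesis
    unfolding density_reachable_iff_tranclp by (induction rule: tranclp_induct) (blast intro: tranclp.intros)+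
qed

lemma cluster_in_larger_bin:
  assumes outY: "dbscan_output Y e m Cs" and outZ: "dbscan_output Z e m Ds"
    and "Y \<subseteq> Z" "finite Z" "m > 0"
    and no_free: "\<not> (\<exists>s. free_border_point Z e m s)"
    and C: "C \<in> set Cs"
  shows "\<exists>!D. D \<in> set Ds \<and> C \<subseteq> D"
proof -
  obtain p where p: "p \<in> C" "core_point Y e m p"
    using dbscan_cluster_has_core[OF outY C] .
  have reach: "density_reachable Z e m p q" if "q \<in> C" for q
  proof -
    have "density_connected Y e m p q"
      using outY C p(1) that unfolding dbscan_output_def in_set_conv_nth by blast
    then show ?thesis
      using p(2) density_connected_core_reachable density_reachable_mono assms(3,4) by blast
  qed
  obtain j where j: "j < length Ds" "p \<in> Ds ! j"
    using dbscan_cluster_of_reachable_point[OF outZ \<open>m > 0\<close> reach[OF p(1)]] .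
  have "C \<subseteq> Ds ! j"
    using cluster_absorbs_reachable[OF outZ \<open>m > 0\<close> no_free] reach j nth_mem by blast
  then show ?thesis
    using j(1) p(1) dbscan_clusters_disjoint[OF outZ] nth_mem by blast
qed

section \<open>The filtration of cluster covers\<close>

theorem theorem3:
  fixes X :: "'a::metric_space set"
    and \<epsilon> :: real and MinPts :: nat
    and I :: "'i::order set"
    and J :: "'i \<Rightarrow> 'b set"
    and B :: "'i \<Rightarrow> 'b \<Rightarrow> 'a set"
    and u :: "'i \<Rightarrow> 'i \<Rightarrow> 'b \<Rightarrow> 'b"
    and Cs :: "'i \<Rightarrow> 'b \<Rightarrow> 'a set list"
  assumes "finite X"
    and "MinPts > 0"
    and "\<And>i. i \<in> I \<Longrightarrow> bin_cover X (J i) (B i)"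
    and "filtration I J B u"
    and "\<And>i b. i \<in> I \<Longrightarrow> b \<in> J i \<Longrightarrow> dbscan_output (B i b) \<epsilon> MinPts (Cs i b)"
    and "\<And>i b. i \<in> I \<Longrightarrow> b \<in> J i \<Longrightarrow> \<not> (\<exists>s. free_border_point (B i b) \<epsilon> MinPts s)"
  shows "\<exists>c. filtration I (\<lambda>i. cluster_cover (J i) (Cs i)) (\<lambda>i. snd) c"
proof -
  have u_in: "u i j b \<in> J j" and u_sub: "B i b \<subseteq> B j (u i j b)"
    if "i \<in> I" "j \<in> I" "i \<le> j" "b \<in> J i" for i j b
    using assms(4) that unfolding filtration_def by blast+
  have u_comp: "u j l (u i j b) = u i l b"
    if "i \<in> I" "j \<in> I" "l \<in> I" "i \<le> j" "j \<le> l" "b \<in> J i" for i j l b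
    using assms(4) that unfolding filtration_def by blast
  have target: "\<exists>!D. D \<in> set (Cs j (u i j b)) \<and> C \<subseteq> D"
    if ij: "i \<in> I" "j \<in> I" "i \<le> j" and b: "b \<in> J i" and C: "C \<in> set (Cs i b)" for i j b C
  proof (rule cluster_in_larger_bin[OF assms(5)[OF ij(1) b] assms(5)[OF ij(2) u_in[OF ij b]]
        u_sub[OF ij b] _ assms(2) assms(6)[OF ij(2) u_in[OF ij b]] C])
    have "B j (u i j b) \<subseteq> X"
      using assms(3)[OF ij(2)] u_in[OF ij b] by (auto simp: bin_cover_def)
    then show "finite (B j (u i j b))"
      using assms(1) finite_subset by blast
  qed
  define c where "c i j = (\<lambda>(b, C). (u i j b, THE D. D \<in> set (Cs j (u i j b)) \<and> C \<subseteq> D))" for i j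
  have c_target: "fst (c i j k) = u i j (fst k)" "snd (c i j k) \<in> set (Cs j (u i j (fst k)))"
      "snd k \<subseteq> snd (c i j k)"
    if "i \<in> I" "j \<in> I" "i \<le> j" "fst k \<in> J i" "snd k \<in> set (Cs i (fst k))" for i j k
    using theI'[OF target[OF that]] by (auto simp: c_def split_beta)
  have c_comp: "c j l (c i j k) = c i l k"
    if I: "i \<in> I" "j \<in> I" "l \<in> I" and le: "i \<le> j" "j \<le> l"
      and k: "fst k \<in> J i" "snd k \<in> set (Cs i (fst k))" for i j l k
  proof -
    have il: "i \<le> l" using le by (rule order_trans)
    note ij = c_target[OF I(1,2) le(1) k]
    have "fst (c i j k) \<in> J j" "snd (c i j k) \<in> set (Cs j (fst (c i j k)))"
      using ij u_in[OF I(1,2) le(1) k(1)] by simp_all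
    note jl = c_target[OF I(2,3) le(2) this]
    have bin: "u j l (fst (c i j k)) = u i l (fst k)"
      using ij(1) u_comp[OF I le k(1)] by simp
    have "snd (c j l (c i j k)) \<in> set (Cs l (u i l (fst k)))" "snd k \<subseteq> snd (c j l (c i j k))"
      using jl(2,3) ij(3) bin by auto
    then have "snd (c j l (c i j k)) = snd (c i l k)"
      using c_target(2,3)[OF I(1,3) il k] target[OF I(1,3) il k] by metis
    moreover have "fst (c j l (c i j k)) = fst (c i l k)"
      using jl(1) bin c_target(1)[OF I(1,3) il k] by simp
    ultimately show ?thesis by (rule prod_eqI[rotated])
  qed
  have in_cover: "k \<in> cluster_cover (J i) (Cs i) \<longleftrightarrow> fst k \<in> J i \<and> snd k \<in> set (Cs i (fst k))"
    for i k by (cases k) (simp add: cluster_cover_def)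
  have "filtration I (\<lambda>i. cluster_cover (J i) (Cs i)) (\<lambda>i. snd) c"
    unfolding filtration_def
  proof (intro conjI ballI impI funcsetI)
    fix i j k assume "i \<in> I" "j \<in> I" "i \<le> j" "k \<in> cluster_cover (J i) (Cs i)"
    then show "c i j k \<in> cluster_cover (J j) (Cs j)" "snd k \<subseteq> snd (c i j k)"
      using c_target[of i j k] u_in[of i j "fst k"] by (simp_all add: in_cover)
  next
    fix i j l k assume "i \<in> I" "j \<in> I" "l \<in> I" "i \<le> j" "j \<le> l" "k \<in> cluster_cover (J i) (Cs i)"
    then show "c j l (c i j k) = c i l k"
      using c_comp by (simp add: in_cover)
  qed
  then show ?thesis by blast
qed

end
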